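(* Let $q$ be an odd prime and $n$ a positive integer. Let $S(n,q)$ be the maximal size of a set $A\subseteq\mathbb{F}_q^n$ which does not contain distinct vectors $x,y$ with $\langle x-y, x-y\rangle=0$. Then $$\binom{n}{q-1}\le S(n,q)\le \binom{n+q}{q-1}-\binom{n+q-2}{q-3}.$$ Moreover, whenever $n\not\equiv -2 \pmod q$ or $q \equiv 1 \pmod 4$, we have $$S(n,q)\ge \binom{n}{q-1}+\binom{n}{q-2}.$$
   Context: $\langle u,v\rangle=\sum_{i=1}^n u_iv_i$ denotes the standard dot product on $\mathbb{F}_q^n$. *)

theory Defs
  imports "HOL-Number_Theory.Residues" "HOL-Library.FuncSet"
begin

text \<open>For a prime q, the ring \<open>residue_ring (int q)\<close>, with carrier
  \<open>{0..int q - 1}\<close>, is the field with q elements.  Vectors are extensional functions on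
  \<open>{1..n}\<close>, so that equality of functions is equality of vectors.\<close>

definition vectors :: "nat \<Rightarrow> nat \<Rightarrow> (nat \<Rightarrow> int) set" where
  "vectors n q = {1..n} \<rightarrow>\<^sub>E carrier (residue_ring (int q))"

definition vec_diff :: "nat \<Rightarrow> nat \<Rightarrow> (nat \<Rightarrow> int) \<Rightarrow> (nat \<Rightarrow> int) \<Rightarrow> (nat \<Rightarrow> int)" where
  "vec_diff n q x y = (\<lambda>i\<in>{1..n}. x i \<ominus>\<^bsub>residue_ring (int q)\<^esub> y i)"

definition dot :: "nat \<Rightarrow> nat \<Rightarrow> (nat \<Rightarrow> int) \<Rightarrow> (nat \<Rightarrow> int) \<Rightarrow> int" where
  "dot n q u v =
     (\<Oplus>\<^bsub>residue_ring (int q)\<^esub> i\<in>{1..n}. u i \<otimes>\<^bsub>residue_ring (int q)\<^esub> v i)"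

definition admissible :: "nat \<Rightarrow> nat \<Rightarrow> (nat \<Rightarrow> int) set \<Rightarrow> bool" where
  "admissible n q A \<longleftrightarrow> A \<subseteq> vectors n q \<and>
     \<not> (\<exists>x\<in>A. \<exists>y\<in>A. x \<noteq> y \<and>
          dot n q (vec_diff n q x y) (vec_diff n q x y) = \<zero>\<^bsub>residue_ring (int q)\<^esub>)"

definition S :: "nat \<Rightarrow> nat \<Rightarrow> nat" where
  "S n q = Max (card ` {A. admissible n q A})"

text \<open>The maximum is taken over a finite nonempty set, hence is attained.\<close>

lemma finite_admissible: "finite {A. admissible n q A}"
proof (rule finite_subset)
  show "{A. admissible n q A} \<subseteq> Pow (vectors n q)"
    by (auto simp: admissible_def)
  show "finite (Pow (vectors n q))"
    by (auto simp: vectors_def residue_ring_def intro!: finite_PiE)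
qed

lemma admissible_empty: "admissible n q {}"
  by (simp add: admissible_def)

lemma S_attained: "\<exists>A. admissible n q A \<and> card A = S n q"
proof -
  have "S n q \<in> card ` {A. admissible n q A}"
    unfolding S_def 
    using finite_admissible admissible_empty[of n q] by (intro Max_in) blast+
  then show ?thesis by auto
qed

lemma card_le_S: "admissible n q A \<Longrightarrow> card A \<le> S n q"
  unfolding S_def using finite_admissible[of n q] by (intro Max_ge) auto

end

theory Submission
  imports Defs "HOL-Number_Theory.Euler_Criterion"
begin

text \<open>
  Upper bound: for $N_x(y) = \langle x-y, x-y\rangle$ the functions $1 - N_x(y)^{q-1}$ with $x \in A$
  restrict to the identity matrix on $A$, so $|A|$ is at most the dimension of any space of functions
  containing them.  Put $z = \sum_i y_i^2$.  Then $N_x$ is a linear form in $1, z, y_1, \dots, y_n$,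
  and $y_1^2 = 1 \cdot z - \sum_{i \ge 2} y_i^2$ is a quadratic form in $1, z, y_2, \dots, y_n$.
  Hence $N_x^{q-1}$ is a form of degree $q-1$ in these $n+1$ functions plus $y_1$ times a form of
  degree $q-2$.

  Lower bound: take the indicator vectors of all $(q-1)$-sets.  One may add all vectors
  $a 1_Y + b (1, \dots, 1)$ with $|Y| = q-2$, provided that $a \ne 0$ and that
  $\langle 1_X - a 1_Y - b, 1_X - a 1_Y - b\rangle$, which is affine in $t = |X \cap Y|$, has its
  root at $t = -1$.  This is the conic $(2a+2b-1)^2 + 1 = 2(n+2) b^2$.
\<close>

section \<open>Integers modulo \<open>q\<close>\<close>

lemma (in residues) finsum_eq_sum_mod:
  assumes "finite I" "\<And>i. i \<in> I \<Longrightarrow> f i \<in> carrier R"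
  shows "(\<Oplus>i\<in>I. f i) = (\<Sum>i\<in>I. f i) mod m"
  using assms
proof (induction I)
  case empty
  then show ?case by (simp add: res_zero_eq)
next
  case (insert j J)
  then show ?case
    by (subst finsum_insert) (auto simp: res_add_eq mod_add_right_eq)
qed

text \<open>The value lives in the integers, so that vanishing in the field becomes divisibility by
  \<open>q\<close> and all later arguments can use integer congruences in place of ring
  operations.\<close>

definition sq_dist :: "nat \<Rightarrow> (nat \<Rightarrow> int) \<Rightarrow> (nat \<Rightarrow> int) \<Rightarrow> int" where
  "sq_dist n x y = (\<Sum>i=1..n. (x i - y i)\<^sup>2)"

lemma dot_vec_diff:
  assumes "q > 1" "x \<in> vectors n q" "y \<in> vectors n q"
  shows "dot n q (vec_diff n q x y) (vec_diff n q x y) = sq_dist n x y mod int q"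
proof -
  interpret residues "int q" "residue_ring (int q)"
    using assms by unfold_locales auto
  let ?R = "residue_ring (int q)"
  have mem: "x i \<in> carrier ?R" "y i \<in> carrier ?R" if "i \<in> {1..n}" for i
    using assms that by (auto simp: vectors_def PiE_iff)
  have diff: "x i \<ominus>\<^bsub>?R\<^esub> y i = (x i - y i) mod int q" if "i \<in> {1..n}" for i
    using that by (simp add: a_minus_def res_add_eq res_neg_eq mod_add_right_eq)
  have "dot n q (vec_diff n q x y) (vec_diff n q x y) =
      (\<Sum>i=1..n. vec_diff n q x y i \<otimes>\<^bsub>?R\<^esub> vec_diff n q x y i) mod int q"
    unfolding dot_def using mem
    by (intro finsum_eq_sum_mod) (auto simp: vec_diff_def intro!: minus_closed m_closed)
  also have "\<dots> = (\<Sum>i=1..n. (x i - y i)\<^sup>2 mod int q) mod int q"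
    by (intro arg_cong2[where f = "(mod)"] sum.cong refl)
      (simp add: vec_diff_def diff res_mult_eq power2_eq_square mod_mult_eq)
  finally show ?thesis
    by (simp add: sq_dist_def mod_sum_eq)
qed

lemma admissible_iff:
  assumes "q > 1"
  shows "admissible n q A \<longleftrightarrow> A \<subseteq> vectors n q \<and>
    (\<forall>x\<in>A. \<forall>y\<in>A. x \<noteq> y \<longrightarrow> \<not> int q dvd sq_dist n x y)"
proof -
  have zero: "\<zero>\<^bsub>residue_ring (int q)\<^esub> = 0"
    by (simp add: residue_ring_def)
  show ?thesis
  proof (cases "A \<subseteq> vectors n q")
    case True
    then have "dot n q (vec_diff n q x y) (vec_diff n q x y) = \<zero>\<^bsub>residue_ring (int q)\<^esub>
        \<longleftrightarrow> int q dvd sq_dist n x y" if "x \<in> A" "y \<in> A" for x y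
      using dot_vec_diff[OF assms, of x n y] that True by (simp only: zero mod_eq_0_iff_dvd subsetD)
    then show ?thesis
      using True unfolding admissible_def by blast
  qed (simp add: admissible_def)
qed

lemma fermat_theorem_int:
  fixes k :: int
  assumes "prime q" "\<not> int q dvd k" "k \<ge> 0"
  shows "[k ^ (q - 1) = 1] (mod int q)"
proof -
  have "[nat k ^ (q - 1) = 1] (mod q)"
    using assms by (intro fermat_theorem) (auto simp: int_dvd_int_iff[symmetric])
  then have "[int (nat k ^ (q - 1)) = int 1] (mod int q)"
    unfolding cong_int_iff .
  then show ?thesis
    using assms by simp
qed

section \<open>The upper bound\<close>

text \<open>A rank inequality modulo \<open>q\<close>, obtained by counting: weights
  \<open>c\<close> on \<open>A\<close> can be recovered from \<open>card M\<close> residues, so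
  \<open>q ^ card A\<close> is at most \<open>q ^ card M\<close>.\<close>

lemma card_le_of_matrix_factorization:
  fixes \<alpha> :: "'a \<Rightarrow> 'b \<Rightarrow> int" and \<mu> :: "'b \<Rightarrow> 'a \<Rightarrow> int"
  assumes "q > 1" "finite A" "finite M"
    and diag: "\<And>x. x \<in> A \<Longrightarrow> [(\<Sum>j\<in>M. \<alpha> x j * \<mu> j x) = 1] (mod int q)"
    and off_diag: "\<And>x y. x \<in> A \<Longrightarrow> y \<in> A \<Longrightarrow> x \<noteq> y \<Longrightarrow> [(\<Sum>j\<in>M. \<alpha> x j * \<mu> j y) = 0] (mod int q)"
  shows "card A \<le> card M"
proof -
  define V where "V = {0..<int q}"
  \<comment> \<open>\<open>T c\<close> holds the coefficients, in the functions
    \<open>\<mu> j\<close>, of the combination of the rows of \<open>\<alpha>\<close> with weights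
    \<open>c\<close>. Evaluating that combination at \<open>y\<close> returns \<open>c y\<close>
    modulo \<open>q\<close>.\<close>
  define T where "T = (\<lambda>c. \<lambda>j\<in>M. (\<Sum>x\<in>A. c x * \<alpha> x j) mod int q)"
  have recover: "[(\<Sum>j\<in>M. T c j * \<mu> j y) = c y] (mod int q)" if "y \<in> A" for c y
  proof -
    have "[(\<Sum>j\<in>M. T c j * \<mu> j y) = (\<Sum>j\<in>M. (\<Sum>x\<in>A. c x * \<alpha> x j) * \<mu> j y)] (mod int q)"
      by (intro cong_sum cong_mult) (auto simp: T_def)
    also have "(\<Sum>j\<in>M. (\<Sum>x\<in>A. c x * \<alpha> x j) * \<mu> j y) = (\<Sum>x\<in>A. c x * (\<Sum>j\<in>M. \<alpha> x j * \<mu> j y))"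
      by (simp add: sum_distrib_left sum_distrib_right mult_ac) (rule sum.swap)
    also have "[\<dots> = (\<Sum>x\<in>A. c x * (if x = y then 1 else 0))] (mod int q)"
      using diag off_diag that by (intro cong_sum cong_mult) auto
    also have "(\<Sum>x\<in>A. c x * (if x = y then 1 else 0)) = c y"
      using \<open>finite A\<close> that by (simp add: if_distrib[of "(*) _"] cong: if_cong)
    finally show ?thesis .
  qed
  have "inj_on T (A \<rightarrow>\<^sub>E V)"
  proof (rule inj_onI)
    fix c d assume c: "c \<in> A \<rightarrow>\<^sub>E V" and d: "d \<in> A \<rightarrow>\<^sub>E V" and eq: "T c = T d"
    show "c = d"
    proof (rule PiE_ext[OF c d])
      fix y assume y: "y \<in> A"
      have "[c y = d y] (mod int q)"
        using recover[OF y, of c] recover[OF y, of d] eq cong_trans cong_sym by metis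
      moreover have "c y \<in> V" "d y \<in> V"
        using y c d by (auto simp: PiE_iff)
      ultimately show "c y = d y"
        by (simp add: V_def cong_def)
    qed
  qed
  moreover have "T ` (A \<rightarrow>\<^sub>E V) \<subseteq> M \<rightarrow>\<^sub>E V"
    using \<open>q > 1\<close> by (auto simp: T_def V_def)
  moreover have "finite (M \<rightarrow>\<^sub>E V)"
    using \<open>finite M\<close> by (intro finite_PiE) (auto simp: V_def)
  ultimately have "card (A \<rightarrow>\<^sub>E V) \<le> card (M \<rightarrow>\<^sub>E V)"
    by (rule card_inj_on_le)
  then have "q ^ card A \<le> q ^ card M"
    using \<open>finite A\<close> \<open>finite M\<close> by (simp add: card_PiE V_def)
  then show ?thesis
    using \<open>q > 1\<close> by simp
qed

section \<open>Forms of a fixed degree in given functions\<close>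

definition exponents :: "nat \<Rightarrow> nat \<Rightarrow> nat list set" where
  "exponents m d = {l. length l = m \<and> sum_list l = d}"

definition monomial :: "(nat \<Rightarrow> 'a \<Rightarrow> int) \<Rightarrow> nat list \<Rightarrow> 'a \<Rightarrow> int" where
  "monomial v l y = (\<Prod>i<length l. v i y ^ (l ! i))"

text \<open>The integer span of the degree \<open>d\<close> monomials in
  \<open>v 0, ..., v (m - 1)\<close>, regarded as functions. The degree belongs to the expression:
  one function may lie in spans of several degrees.\<close>

definition forms :: "(nat \<Rightarrow> 'a \<Rightarrow> int) \<Rightarrow> nat \<Rightarrow> nat \<Rightarrow> ('a \<Rightarrow> int) set" where
  "forms v m d = {g. \<exists>c. \<forall>y. g y = (\<Sum>l\<in>exponents m d. c l * monomial v l y)}"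

lemma finite_exponents: "finite (exponents m d)"
proof (rule finite_subset)
  show "exponents m d \<subseteq> {l. set l \<subseteq> {..d} \<and> length l = m}"
    by (auto simp: exponents_def dest: member_le_sum_list)
qed (simp add: finite_lists_length_eq)

lemma card_exponents: "card (exponents m d) = (d + m - 1) choose d"
  unfolding exponents_def by (rule card_length_sum_list)

lemma forms_add:
  assumes "f \<in> forms v m d" "g \<in> forms v m d"
  shows "(\<lambda>y. f y + g y) \<in> forms v m d"
proof -
  obtain a b where "\<forall>y. f y = (\<Sum>l\<in>exponents m d. a l * monomial v l y)"
    "\<forall>y. g y = (\<Sum>l\<in>exponents m d. b l * monomial v l y)"
    using assms by (auto simp: forms_def)
  then have "\<forall>y. f y + g y = (\<Sum>l\<in>exponents m d. (a l + b l) * monomial v l y)"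
    by (simp add: sum.distrib distrib_right)
  then show ?thesis
    unfolding forms_def by (intro CollectI exI)
qed

lemma forms_scale:
  assumes "f \<in> forms v m d"
  shows "(\<lambda>y. k * f y) \<in> forms v m d"
proof -
  obtain a where "\<forall>y. f y = (\<Sum>l\<in>exponents m d. a l * monomial v l y)"
    using assms by (auto simp: forms_def)
  then have "\<forall>y. k * f y = (\<Sum>l\<in>exponents m d. (k * a l) * monomial v l y)"
    by (simp add: sum_distrib_left mult.assoc)
  then show ?thesis
    unfolding forms_def by (intro CollectI exI)
qed

lemma forms_zero: "(\<lambda>y. 0) \<in> forms v m d"
  unfolding forms_def by (auto intro!: exI[of _ "\<lambda>_. 0"])

lemma forms_sum:
  assumes "\<And>i. i \<in> I \<Longrightarrow> f i \<in> forms v m d"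
  shows "(\<lambda>y. \<Sum>i\<in>I. f i y) \<in> forms v m d"
  using assms by (induction I rule: infinite_finite_induct) (auto intro: forms_zero forms_add)

lemma forms_diff:
  assumes "f \<in> forms v m d" "g \<in> forms v m d"
  shows "(\<lambda>y. f y - g y) \<in> forms v m d"
  using forms_add[OF assms(1) forms_scale[OF assms(2), of "-1"]] by simp

lemma monomial_in_forms:
  assumes "l \<in> exponents m d"
  shows "monomial v l \<in> forms v m d"
proof -
  have "\<forall>y. monomial v l y = (\<Sum>k\<in>exponents m d. (if k = l then 1 else 0) * monomial v k y)"
    using assms finite_exponents by (simp add: if_distrib[of "\<lambda>x. x * _"] cong: if_cong)
  then show ?thesis
    unfolding forms_def by (intro CollectI exI)
qed

lemma const_in_forms: "(\<lambda>y. k) \<in> forms v m 0"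
proof -
  have "replicate m 0 \<in> exponents m 0"
    by (simp add: exponents_def sum_list_replicate)
  from forms_scale[OF monomial_in_forms[OF this], of k] show ?thesis
    by (simp add: monomial_def)
qed

text \<open>On a monomial the factor \<open>v i\<close> raises entry \<open>i\<close> of the
  exponent list by one; linearity does the rest.\<close>

lemma var_times_forms:
  assumes "i < m" "f \<in> forms v m d"
  shows "(\<lambda>y. v i y * f y) \<in> forms v m (Suc d)"
proof -
  obtain c where c: "\<forall>y. f y = (\<Sum>l\<in>exponents m d. c l * monomial v l y)"
    using assms by (auto simp: forms_def)
  have "(\<lambda>y. v i y * monomial v l y) \<in> forms v m (Suc d)" if "l \<in> exponents m d" for l
  proof -
    define l' where "l' = l[i := Suc (l ! i)]"
    have len: "length l = m" "i < length l"
      using that assms by (auto simp: exponents_def)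
    have "sum_list l' = Suc (sum_list l)"
      using len elem_le_sum_list[of i l] by (simp add: l'_def sum_list_update)
    then have "l' \<in> exponents m (Suc d)"
      using that by (auto simp: exponents_def l'_def)
    moreover have "monomial v l' = (\<lambda>y. v i y * monomial v l y)"
    proof
      fix y
      have "monomial v l' y = v i y ^ (l' ! i) * (\<Prod>j\<in>{..<length l} - {i}. v j y ^ (l' ! j))"
        using len unfolding monomial_def by (subst prod.remove[of _ i]) (auto simp: l'_def)
      also have "\<dots> = v i y * (v i y ^ (l ! i) * (\<Prod>j\<in>{..<length l} - {i}. v j y ^ (l ! j)))"
        using len by (simp add: l'_def)
      also have "\<dots> = v i y * monomial v l y"
        using len unfolding monomial_def by (subst prod.remove[of "{..<length l}" i]) auto
      finally show "monomial v l' y = v i y * monomial v l y" .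
    qed
    ultimately show ?thesis
      using monomial_in_forms by metis
  qed
  then have "(\<lambda>y. \<Sum>l\<in>exponents m d. c l * (v i y * monomial v l y)) \<in> forms v m (Suc d)"
    by (intro forms_sum forms_scale)
  then show ?thesis
    by (simp add: c sum_distrib_left mult_ac)
qed

lemma linear_times_forms:
  assumes "f \<in> forms v m d"
  shows "(\<lambda>y. (\<Sum>i<m. a i * v i y) * f y) \<in> forms v m (Suc d)"
proof -
  have "(\<lambda>y. \<Sum>i<m. a i * (v i y * f y)) \<in> forms v m (Suc d)"
    using assms by (intro forms_sum forms_scale var_times_forms) auto
  then show ?thesis
    by (simp add: sum_distrib_right mult.assoc)
qed

section \<open>Powers of the squared distance as forms\<close>

text \<open>Homogeneous coordinates: index 0 stands for the constant 1, and index 1 for the squared norm.\<close>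

definition coords :: "nat \<Rightarrow> nat \<Rightarrow> (nat \<Rightarrow> int) \<Rightarrow> int" where
  "coords n i y = (if i = 0 then 1 else if i = 1 then \<Sum>j=1..n. (y j)\<^sup>2 else y i)"

text \<open>\<open>y 1\<close> itself is not a coordinate, but its square is 1 times the squared
  norm minus the squares of the other entries. Each of these terms is a product of two coordinates,
  so the degree grows by exactly 2.\<close>

lemma first_coord_sq_times_forms:
  assumes "n > 0" "f \<in> forms (coords n) (Suc n) d"
  shows "(\<lambda>y. (y 1)\<^sup>2 * f y) \<in> forms (coords n) (Suc n) (Suc (Suc d))"
proof -
  have "(\<lambda>y. coords n 0 y * (coords n 1 y * f y) - (\<Sum>i=2..n. coords n i y * (coords n i y * f y)))
      \<in> forms (coords n) (Suc n) (Suc (Suc d))"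
    using assms by (intro forms_diff forms_sum var_times_forms) auto
  moreover have "coords n 0 y * (coords n 1 y * f y) - (\<Sum>i=2..n. coords n i y * (coords n i y * f y))
      = (y 1)\<^sup>2 * f y" for y
  proof -
    have "(\<Sum>j=1..n. (y j)\<^sup>2) = (y 1)\<^sup>2 + (\<Sum>j=2..n. (y j)\<^sup>2)"
      using \<open>n > 0\<close> by (simp add: sum.atLeast_Suc_atMost numeral_2_eq_2)
    moreover have "(\<Sum>i=2..n. coords n i y * (coords n i y * f y)) = (\<Sum>j=2..n. (y j)\<^sup>2) * f y"
      by (simp add: coords_def sum_distrib_right power2_eq_square mult.assoc)
    ultimately show ?thesis
      by (simp add: coords_def algebra_simps)
  qed
  ultimately show ?thesis
    by simp
qed

text \<open>Expanding the squares gives |x|^2 + |y|^2 - 2 sum x_j y_j. The summand with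
  \<open>y 1\<close> stays apart because \<open>y 1\<close> is not among the coordinates.\<close>

lemma sq_dist_linear:
  assumes "n > 0"
  obtains a :: "nat \<Rightarrow> int" and \<beta> :: int
  where "\<And>y. sq_dist n x y = (\<Sum>i<Suc n. a i * coords n i y) + \<beta> * y 1"
proof
  fix y
  define a where "a = (\<lambda>i. if i = 0 then \<Sum>j=1..n. (x j)\<^sup>2 else if i = 1 then 1 else - 2 * x i)"
  have split: "(\<Sum>i=1..n. g i) = g 1 + (\<Sum>i=2..n. g i)" for g :: "nat \<Rightarrow> int"
    using \<open>n > 0\<close> by (simp add: sum.atLeast_Suc_atMost numeral_2_eq_2)
  have "sq_dist n x y = (\<Sum>j=1..n. (x j)\<^sup>2) + (\<Sum>j=1..n. (y j)\<^sup>2) + (\<Sum>j=1..n. - 2 * x j * y j)"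
    unfolding sq_dist_def sum.distrib[symmetric]
    by (intro sum.cong) (auto simp: power2_eq_square algebra_simps)
  also have "(\<Sum>j=1..n. - 2 * x j * y j) = - 2 * x 1 * y 1 + (\<Sum>j=2..n. - 2 * x j * y j)"
    by (rule split)
  also have "(\<Sum>j=2..n. - 2 * x j * y j) = (\<Sum>j=2..n. a j * coords n j y)"
    by (intro sum.cong) (auto simp: a_def coords_def)
  also have "(\<Sum>j=1..n. (x j)\<^sup>2) = a 0 * coords n 0 y"
    by (simp add: a_def coords_def)
  also have "(\<Sum>j=1..n. (y j)\<^sup>2) = a 1 * coords n 1 y"
    by (simp add: a_def coords_def)
  finally have "sq_dist n x y =
      a 0 * coords n 0 y + (a 1 * coords n 1 y + (\<Sum>j=2..n. a j * coords n j y)) + - 2 * x 1 * y 1"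
    by simp
  also have "a 1 * coords n 1 y + (\<Sum>j=2..n. a j * coords n j y) = (\<Sum>j=1..n. a j * coords n j y)"
    by (rule split[symmetric])
  also have "a 0 * coords n 0 y + \<dots> = (\<Sum>i<Suc n. a i * coords n i y)"
    by (simp add: lessThan_Suc_atMost atMost_atLeast0 sum.atLeast_Suc_atMost del: sum.lessThan_Suc)
  \<comment> \<open>\<open>a\<close> was introduced after \<open>y\<close> was fixed; unfolding it
    exhibits coefficients that depend on \<open>x\<close> alone.\<close>
  finally show "sq_dist n x y = (\<Sum>i<Suc n. a i * coords n i y) + (- 2 * x 1) * y 1" 
    unfolding a_def .
qed

text \<open>With L the linear part, (L + \<beta> y_1)(f + y_1 g) = (L f + \<beta> y_1^2 g) + y_1
  (\<beta> f + L g). Since y_1^2 g is again a form, y_1 never has to occur outside with exponent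
  above 1.\<close>

lemma sq_dist_power:
  assumes "n > 0"
  shows "\<exists>f \<in> forms (coords n) (Suc n) (Suc k). \<exists>g \<in> forms (coords n) (Suc n) k.
    \<forall>y. sq_dist n x y ^ Suc k = f y + y 1 * g y"
proof -
  obtain a \<beta> where lin: "\<And>y. sq_dist n x y = (\<Sum>i<Suc n. a i * coords n i y) + \<beta> * y 1"
    using sq_dist_linear[OF assms] by blast
  show ?thesis
  proof (induction k)
    case 0
    have "(\<lambda>y. (\<Sum>i<Suc n. a i * coords n i y) * 1) \<in> forms (coords n) (Suc n) (Suc 0)"
      by (intro linear_times_forms const_in_forms)
    moreover have "\<forall>y. sq_dist n x y ^ Suc 0 = (\<Sum>i<Suc n. a i * coords n i y) * 1 + y 1 * \<beta>"
      by (simp add: lin del: sum.lessThan_Suc)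
    ultimately show ?case
      using const_in_forms[of \<beta>] by fast
  next
    case (Suc k)
    then obtain f g where f: "f \<in> forms (coords n) (Suc n) (Suc k)"
      and g: "g \<in> forms (coords n) (Suc n) k"
      and fg: "\<forall>y. sq_dist n x y ^ Suc k = f y + y 1 * g y"
      by blast
    let ?f = "\<lambda>y. (\<Sum>i<Suc n. a i * coords n i y) * f y + \<beta> * ((y 1)\<^sup>2 * g y)"
    let ?g = "\<lambda>y. \<beta> * f y + (\<Sum>i<Suc n. a i * coords n i y) * g y"
    have "?f \<in> forms (coords n) (Suc n) (Suc (Suc k))"
      using assms f g
      by (intro forms_add linear_times_forms forms_scale first_coord_sq_times_forms)
    moreover have "?g \<in> forms (coords n) (Suc n) (Suc k)"
      using f g by (intro forms_add linear_times_forms forms_scale)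
    moreover have "\<forall>y. sq_dist n x y ^ Suc (Suc k) = ?f y + y 1 * ?g y"
    proof
      fix y
      have "sq_dist n x y ^ Suc (Suc k) =
          ((\<Sum>i<Suc n. a i * coords n i y) + \<beta> * y 1) * (f y + y 1 * g y)"
        using fg lin[of y] by (metis power_Suc)
      then show "sq_dist n x y ^ Suc (Suc k) = ?f y + y 1 * ?g y"
        by (simp add: algebra_simps power2_eq_square del: sum.lessThan_Suc)
    qed
    ultimately show ?case
      by (intro bexI[of _ ?f] bexI[of _ ?g])
  qed
qed

section \<open>The dimension count\<close>

text \<open>The spanning family has one function for each monomial of degree \<open>q - 1\<close> in
  the \<open>n + 1\<close> coordinates and, with the extra factor \<open>y 1\<close>, one for each
  monomial of degree \<open>q - 2\<close>. These two numbers are the summands of the bound.\<close>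

lemma card_admissible_le:
  assumes "prime q" "odd q" "n > 0" "admissible n q A"
  shows "card A \<le> ((n + q - 1) choose (q - 1)) + ((n + q - 2) choose (q - 2))"
proof -
  have "q > 2"
    using assms(1,2) prime_ge_2_nat[of q] by (cases "q = 2") auto
  define k where "k = q - 2"
  have k: "q - 1 = Suc k"
    using \<open>q > 2\<close> by (simp add: k_def)
  have A: "A \<subseteq> vectors n q" "\<And>x y. x \<in> A \<Longrightarrow> y \<in> A \<Longrightarrow> x \<noteq> y \<Longrightarrow> \<not> int q dvd sq_dist n x y"
    using assms(4) \<open>q > 2\<close> by (auto simp: admissible_iff)
  have "finite A"
    using A(1) by (rule finite_subset) (auto simp: vectors_def residue_ring_def intro!: finite_PiE)
  define M where "M = exponents (Suc n) (Suc k) \<union> exponents (Suc n) k"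
  have disj: "exponents (Suc n) (Suc k) \<inter> exponents (Suc n) k = {}"
    by (auto simp: exponents_def)
  have "finite M"
    by (simp add: M_def finite_exponents)
  \<comment> \<open>The degree of a list in \<open>M\<close> tells which half it comes from; the
    lists of the lower degree \<open>k\<close> carry the factor \<open>y 1\<close>.\<close>
  define \<mu> where "\<mu> = (\<lambda>l y. if sum_list l = k then y 1 * monomial (coords n) l y else monomial (coords n) l y)"
  have "\<exists>c. \<forall>y. 1 - sq_dist n x y ^ (q - 1) = (\<Sum>l\<in>M. c l * \<mu> l y)" for x
  proof -
    obtain f g where f: "f \<in> forms (coords n) (Suc n) (Suc k)"
      and g: "g \<in> forms (coords n) (Suc n) k"
      and fg: "\<forall>y. sq_dist n x y ^ Suc k = f y + y 1 * g y"
      using sq_dist_power[OF \<open>n > 0\<close>] by blast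
    \<comment> \<open>Coordinate 0 is the constant 1, so its powers place 1 in every degree. This
      puts 1 - f in the same span as f.\<close>
    have one: "(\<lambda>y. 1) \<in> forms (coords n) (Suc n) d" for d
    proof (induction d)
      case 0
      show ?case by (rule const_in_forms)
    next
      case (Suc d)
      from var_times_forms[OF _ this, of 0] show ?case
        by (simp add: coords_def)
    qed
    obtain a where a: "\<And>y. 1 - f y = (\<Sum>l\<in>exponents (Suc n) (Suc k). a l * monomial (coords n) l y)"
      using forms_diff[OF one f] by (auto simp: forms_def)
    obtain b where b: "\<And>y. - 1 * g y = (\<Sum>l\<in>exponents (Suc n) k. b l * monomial (coords n) l y)"
      using forms_scale[OF g, of "-1"] by (auto simp: forms_def)
    define c where "c = (\<lambda>l. if sum_list l = k then b l else a l)"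
    have "1 - sq_dist n x y ^ (q - 1) = (\<Sum>l\<in>M. c l * \<mu> l y)" for y
    proof -
      have "1 - sq_dist n x y ^ (q - 1) = (1 - f y) + y 1 * (- 1 * g y)"
        using fg[folded k, rule_format, of y] by simp
      also have "1 - f y = (\<Sum>l\<in>exponents (Suc n) (Suc k). c l * \<mu> l y)"
        unfolding a by (intro sum.cong) (auto simp: c_def \<mu>_def exponents_def)
      also have "y 1 * (- 1 * g y) = (\<Sum>l\<in>exponents (Suc n) k. c l * \<mu> l y)"
        unfolding b sum_distrib_left by (intro sum.cong) (auto simp: c_def \<mu>_def exponents_def)
      finally show ?thesis
        using disj by (simp add: M_def sum.union_disjoint finite_exponents)
    qed
    then show ?thesis by blast
  qed
  then obtain \<alpha> where \<alpha>: "\<And>x y. 1 - sq_dist n x y ^ (q - 1) = (\<Sum>l\<in>M. \<alpha> x l * \<mu> l y)"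
    by metis
  have "card A \<le> card M"
  proof (rule card_le_of_matrix_factorization[of q A M \<alpha> \<mu>])
    fix x
    have "sq_dist n x x = 0"
      by (simp add: sq_dist_def)
    then show "[(\<Sum>l\<in>M. \<alpha> x l * \<mu> l x) = 1] (mod int q)"
      unfolding \<alpha>[symmetric] using \<open>q > 2\<close> by (simp add: power_0_left)
  next
    fix x y assume "x \<in> A" "y \<in> A" "x \<noteq> y"
    then have "[sq_dist n x y ^ (q - 1) = 1] (mod int q)"
      using A \<open>prime q\<close> by (intro fermat_theorem_int) (auto simp: sq_dist_def intro: sum_nonneg)
    then have "[1 - sq_dist n x y ^ (q - 1) = 1 - 1] (mod int q)"
      by (intro cong_diff cong_refl)
    then show "[(\<Sum>l\<in>M. \<alpha> x l * \<mu> l y) = 0] (mod int q)"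
      unfolding \<alpha>[symmetric] by simp
  qed (use \<open>q > 2\<close> \<open>finite A\<close> \<open>finite M\<close> in auto)
  also have "card M = ((Suc k + n) choose Suc k) + ((k + n) choose k)"
    using disj by (simp add: M_def card_Un_disjoint finite_exponents card_exponents)
  also have "Suc k + n = n + q - 1"
    using k \<open>q > 2\<close> by linarith
  also have "k + n = n + q - 2"
    using k \<open>q > 2\<close> by linarith
  finally show ?thesis
    unfolding k unfolding k_def .
qed

text \<open>Pascal's rule twice. The additive form avoids truncated subtraction on natural
  numbers.\<close>

lemma binomial_identity:
  assumes "q \<ge> 3"
  shows "((n + q - 1) choose (q - 1)) + ((n + q - 2) choose (q - 2)) + ((n + q - 2) choose (q - 3))
    = (n + q) choose (q - 1)"
proof -
  obtain k where q: "q = Suc (Suc (Suc k))"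
    using assms by (intro that[of "q - 3"]) simp
  have "n + q - 1 = Suc (Suc (n + k))" "n + q - 2 = Suc (n + k)" "n + q = Suc (Suc (Suc (n + k)))"
    "q - 1 = Suc (Suc k)" "q - 2 = Suc k" "q - 3 = k"
    by (simp_all add: q)
  then show ?thesis
    using binomial_Suc_Suc[of "Suc (Suc (n + k))" "Suc k"] binomial_Suc_Suc[of "Suc (n + k)" k]
    by (simp only:)
qed

section \<open>The lower bound\<close>

text \<open>The distance condition on indices already forces injectivity: equal vectors have
  distance 0, which \<open>q\<close> divides.\<close>

lemma card_le_S_family:
  assumes "q > 1" "\<And>i. i \<in> I \<Longrightarrow> g i \<in> vectors n q"
    and "\<And>i j. i \<in> I \<Longrightarrow> j \<in> I \<Longrightarrow> i \<noteq> j \<Longrightarrow> \<not> int q dvd sq_dist n (g i) (g j)"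
  shows "card I \<le> S n q"
proof -
  have "sq_dist n x x = 0" for x
    by (simp add: sq_dist_def)
  then have "inj_on g I"
    using assms(3) by (metis dvd_0_right inj_onI)
  moreover have "admissible n q (g ` I)"
    using assms by (auto simp: admissible_iff)
  ultimately show ?thesis
    using card_le_S[of n q "g ` I"] by (simp add: card_image)
qed

section \<open>Two-valued vectors and their distances\<close>

text \<open>This is a 1_X + b (1, ..., 1); the values a = 1, b = 0 give the indicator vector of
  X.\<close>

definition two_valued :: "nat \<Rightarrow> nat \<Rightarrow> int \<Rightarrow> int \<Rightarrow> nat set \<Rightarrow> nat \<Rightarrow> int" where
  "two_valued n q a b X = (\<lambda>i\<in>{1..n}. (a * of_bool (i \<in> X) + b) mod int q)"

lemma two_valued_in_vectors: "q > 0 \<Longrightarrow> two_valued n q a b X \<in> vectors n q"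
  by (auto simp: two_valued_def vectors_def residue_ring_def)

text \<open>Indicators are idempotent and multiply to the indicator of the intersection, so after
  expanding the square only three cardinalities remain.\<close>

lemma sq_dist_two_valued:
  assumes "X \<subseteq> {1..n}" "Y \<subseteq> {1..n}"
  shows "[sq_dist n (two_valued n q a b X) (two_valued n q c d Y) =
    a\<^sup>2 * int (card X) + c\<^sup>2 * int (card Y) - 2 * a * c * int (card (X \<inter> Y))
      + (b - d)\<^sup>2 * int n + 2 * (b - d) * (a * int (card X) - c * int (card Y))] (mod int q)"
proof -
  have card: "(\<Sum>i=1..n. of_bool (i \<in> Z)) = int (card Z)" if "Z \<subseteq> {1..n}" for Z
    using that by (simp add: of_bool_def sum.If_cases Int_absorb1)
  have XY: "X \<inter> Y \<subseteq> {1..n}"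
    using assms by blast
  have "[sq_dist n (two_valued n q a b X) (two_valued n q c d Y) =
      (\<Sum>i=1..n. (a * of_bool (i \<in> X) + b - (c * of_bool (i \<in> Y) + d))\<^sup>2)] (mod int q)"
    unfolding sq_dist_def
    by (intro cong_sum cong_pow cong_diff) (auto simp: two_valued_def)
  also have "(\<Sum>i=1..n. (a * of_bool (i \<in> X) + b - (c * of_bool (i \<in> Y) + d))\<^sup>2) =
      (\<Sum>i=1..n. (a\<^sup>2 + 2 * (b - d) * a) * of_bool (i \<in> X) + (c\<^sup>2 - 2 * (b - d) * c) * of_bool (i \<in> Y)
        - 2 * a * c * of_bool (i \<in> X \<inter> Y) + (b - d)\<^sup>2)"
    by (intro sum.cong) (auto simp: power2_eq_square algebra_simps)
  also have "\<dots> = (a\<^sup>2 + 2 * (b - d) * a) * int (card X) + (c\<^sup>2 - 2 * (b - d) * c) * int (card Y)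
        - 2 * a * c * int (card (X \<inter> Y)) + int n * (b - d)\<^sup>2"
    by (simp only: sum.distrib sum_subtractf sum_distrib_left[symmetric] card[OF assms(1)]
        card[OF assms(2)] card[OF XY]) simp
  finally show ?thesis
    by (simp add: algebra_simps)
qed

text \<open>The shift \<open>b\<close> cancels and the distance is 2 a^2 (k - |X \<inter> Y|), where
  the last factor lies strictly between 0 and \<open>q\<close>.\<close>

lemma not_dvd_sq_dist_same_type:
  assumes "prime q" "odd q" "\<not> int q dvd a"
    and "X \<subseteq> {1..n}" "Y \<subseteq> {1..n}" "X \<noteq> Y" "card X = k" "card Y = k" "k < q"
  shows "\<not> int q dvd sq_dist n (two_valued n q a b X) (two_valued n q a b Y)"
proof
  assume "int q dvd sq_dist n (two_valued n q a b X) (two_valued n q a b Y)"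
  then have dvd: "int q dvd 2 * (a * (a * (int k - int (card (X \<inter> Y)))))"
    using cong_dvd_iff[OF sq_dist_two_valued[OF assms(4,5), of q a b a b]] assms(7,8)
    by (simp add: power2_eq_square algebra_simps)
  have "finite X" "finite Y"
    using assms(4,5) finite_subset by blast+
  have "card (X \<inter> Y) < k"
  proof (rule ccontr)
    assume "\<not> card (X \<inter> Y) < k"
    then have "card (X \<inter> Y) = k"
      using \<open>finite X\<close> assms(7) card_mono[of X "X \<inter> Y"] by simp
    then have "X \<inter> Y = X" "X \<inter> Y = Y"
      using \<open>finite X\<close> \<open>finite Y\<close> assms(7,8) by (intro card_subset_eq; simp)+
    then show False
      using \<open>X \<noteq> Y\<close> by simp
  qed
  then have "\<not> int q dvd int k - int (card (X \<inter> Y))"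
    using zdvd_imp_le[of "int q" "int k - int (card (X \<inter> Y))"] \<open>k < q\<close> by linarith
  moreover have "\<not> int q dvd 2"
    using \<open>prime q\<close> \<open>odd q\<close> zdvd_imp_le[of "int q" 2] prime_ge_2_nat[of q] by (cases "q = 2") auto
  moreover have "prime (int q)"
    using \<open>prime q\<close> by simp
  ultimately show False
    using dvd \<open>\<not> int q dvd a\<close> by (simp only: prime_dvd_mult_iff) blast
qed

text \<open>Modulo \<open>q\<close> the sizes are -1 and -2, and the distance is affine in t = |X
  \<inter> Y| with slope -2a. The conic puts its root at t = -1, which no intersection size attains
  modulo \<open>q\<close>.\<close>

lemma not_dvd_sq_dist_mixed_type:
  assumes "prime q" "odd q" "\<not> int q dvd a"
    and conic: "int q dvd (2 * (a + b) - 1)\<^sup>2 + 1 - 2 * (int n + 2) * b\<^sup>2"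
    and "X \<subseteq> {1..n}" "Y \<subseteq> {1..n}" "card X = q - 1" "card Y = q - 2"
  shows "\<not> int q dvd sq_dist n (two_valued n q 1 0 X) (two_valued n q a b Y)"
    and "\<not> int q dvd sq_dist n (two_valued n q a b Y) (two_valued n q 1 0 X)"
proof -
  have "q > 2"
    using assms(1,2) prime_ge_2_nat[of q] by (cases "q = 2") auto
  define t where "t = int (card (X \<inter> Y))"
  define d where "d = sq_dist n (two_valued n q 1 0 X) (two_valued n q a b Y)"
  have sym: "sq_dist n (two_valued n q a b Y) (two_valued n q 1 0 X) = d"
    by (simp add: d_def sq_dist_def power2_commute)
  have "\<not> int q dvd d"
  proof
    assume d: "int q dvd d"
    define e where "e = 1 * (int q - 1) + a\<^sup>2 * (int q - 2) - 2 * 1 * a * t + b\<^sup>2 * int n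
      - 2 * b * (int q - 1 - a * (int q - 2))"
    have "int (card X) = int q - 1" "int (card Y) = int q - 2"
      using assms(7,8) \<open>q > 2\<close> by auto
    then have "[d = 1\<^sup>2 * (int q - 1) + a\<^sup>2 * (int q - 2) - 2 * 1 * a * t
        + (0 - b)\<^sup>2 * int n + 2 * (0 - b) * (1 * (int q - 1) - a * (int q - 2))] (mod int q)"
      using sq_dist_two_valued[OF assms(5,6), of q 1 0 a b] by (simp only: d_def t_def)
    then have "[d = e] (mod int q)"
      by (simp add: e_def)
    then have "int q dvd e"
      using d cong_dvd_iff by blast
    \<comment> \<open>Modulo \<open>q\<close>, 4a(t + 1) is -2e minus the conic expression; the
      multiple of \<open>q\<close> collects what the sizes \<open>q - 1\<close> and
      \<open>q - 2\<close> contribute beyond -1 and -2.\<close>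
    moreover have "2 * (2 * (a * (t + 1))) = int q * (2 * (1 + a\<^sup>2 - 2 * b + 2 * a * b))
        - 2 * e - ((2 * (a + b) - 1)\<^sup>2 + 1 - 2 * (int n + 2) * b\<^sup>2)"
      unfolding e_def by (simp add: power2_eq_square algebra_simps)
    ultimately have "int q dvd 2 * (2 * (a * (t + 1)))"
      using conic by (simp only: dvd_diff dvd_mult dvd_triv_left)
    \<comment> \<open>Here the size \<open>q - 2\<close> of Y matters: t is at most
      \<open>q - 2\<close>, so t + 1 lies between 1 and \<open>q - 1\<close>.\<close>
    moreover have "t + 1 \<le> int q - 1" "t \<ge> 0"
      using card_mono[of Y "X \<inter> Y"] assms(6,8) \<open>q > 2\<close> finite_subset[OF assms(6)]
      by (auto simp: t_def)
    then have "\<not> int q dvd t + 1"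
      using zdvd_imp_le[of "int q" "t + 1"] by linarith
    moreover have "\<not> int q dvd 2"
      using \<open>q > 2\<close> zdvd_imp_le[of "int q" 2] by auto
    moreover have "prime (int q)"
      using \<open>prime q\<close> by simp
    ultimately show False
      using \<open>\<not> int q dvd a\<close> by (simp only: prime_dvd_mult_iff) blast
  qed
  then show "\<not> int q dvd sq_dist n (two_valued n q 1 0 X) (two_valued n q a b Y)"
    "\<not> int q dvd sq_dist n (two_valued n q a b Y) (two_valued n q 1 0 X)"
    using sym by (simp_all add: d_def)
qed

lemma binomial_le_S:
  assumes "prime q" "odd q"
  shows "n choose (q - 1) \<le> S n q"
proof -
  have "q > 1"
    using \<open>prime q\<close> prime_gt_1_nat by blast
  then have "card {X. X \<subseteq> {1..n} \<and> card X = q - 1} \<le> S n q"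
    using not_dvd_sq_dist_same_type[OF assms, of 1 _ n _ "q - 1" 0]
    by (intro card_le_S_family[of q _ "two_valued n q 1 0"] two_valued_in_vectors) auto
  then show ?thesis
    by (simp add: n_subsets)
qed

lemma binomial_sum_le_S:
  assumes "prime q" "odd q" "\<not> int q dvd a"
    and "int q dvd (2 * (a + b) - 1)\<^sup>2 + 1 - 2 * (int n + 2) * b\<^sup>2"
  shows "(n choose (q - 1)) + (n choose (q - 2)) \<le> S n q"
proof -
  have "q > 2"
    using assms(1,2) prime_ge_2_nat[of q] by (cases "q = 2") auto
  then have "\<not> int q dvd 1"
    by simp
  define F where "F = (\<lambda>k. {X. X \<subseteq> {1..n} \<and> card X = k})"
  \<comment> \<open>The size of an index set decides its type: \<open>q - 1\<close> gives an
    indicator vector, \<open>q - 2\<close> a vector with parameters \<open>a\<close> and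
    \<open>b\<close>.\<close>
  define g where "g = (\<lambda>X. if card X = q - 1 then two_valued n q 1 0 X else two_valued n q a b X)"
  have neq: "q - 2 \<noteq> q - 1" "q - 1 < q" "q - 2 < q"
    using \<open>q > 2\<close> by auto
  have "card (F (q - 1) \<union> F (q - 2)) \<le> S n q"
  proof (rule card_le_S_family[of q _ g])
    show "q > 1"
      using \<open>q > 2\<close> by simp
    show "g X \<in> vectors n q" for X
      using \<open>q > 2\<close> by (simp add: g_def two_valued_in_vectors)
    fix X Y assume "X \<in> F (q - 1) \<union> F (q - 2)" "Y \<in> F (q - 1) \<union> F (q - 2)" "X \<noteq> Y"
    then show "\<not> int q dvd sq_dist n (g X) (g Y)"
      using not_dvd_sq_dist_same_type[OF assms(1,2) \<open>\<not> int q dvd 1\<close>, of X n Y "q - 1" 0]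
        not_dvd_sq_dist_same_type[OF assms(1-3), of X n Y "q - 2" b]
        not_dvd_sq_dist_mixed_type[OF assms, of X Y] not_dvd_sq_dist_mixed_type[OF assms, of Y X] neq
      by (auto simp: F_def g_def)
  qed
  moreover have "F (q - 1) \<inter> F (q - 2) = {}"
    using neq by (auto simp: F_def)
  moreover have "finite (F k)" for k
    by (simp add: F_def)
  ultimately show ?thesis
    by (simp add: card_Un_disjoint) (simp add: F_def n_subsets)
qed

section \<open>Points on the conic\<close>

text \<open>Pigeonhole: u^2 + 1 and d b^2 each take (q + 1) / 2 residues, which is too many for two
  disjoint sets.\<close>

lemma conic_solvable:
  fixes d :: int
  assumes "prime q" "odd q" "\<not> int q dvd d"
  shows "\<exists>u b. int q dvd u\<^sup>2 + 1 - d * b\<^sup>2"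
proof -
  obtain h where h: "q = 2 * h + 1"
    using \<open>odd q\<close> oddE by blast
  \<comment> \<open>Squaring is injective modulo \<open>q\<close> on 0, ..., (q - 1) / 2, because
    sums of two elements stay below \<open>q\<close>.\<close>
  define P where "P = {0..int h}"
  define f where "f = (\<lambda>u::int. (u\<^sup>2 + 1) mod int q)"
  define g where "g = (\<lambda>b::int. (d * b\<^sup>2) mod int q)"
  have prime: "prime (int q)"
    using \<open>prime q\<close> by simp
  have sq_inj: "u = w" if "u \<in> P" "w \<in> P" "int q dvd u\<^sup>2 - w\<^sup>2" for u w
  proof -
    have "int q dvd (u - w) * (u + w)"
      using that(3) by (simp add: power2_eq_square algebra_simps)
    then consider "int q dvd u - w" | "int q dvd u + w"
      using prime prime_dvd_multD by blast
    then show ?thesis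
    proof cases
      case 1
      moreover have "\<bar>u - w\<bar> < \<bar>int q\<bar>"
        using that(1,2) h by (auto simp: P_def)
      ultimately show ?thesis
        using dvd_imp_le_int[of "u - w" "int q"] by fastforce
    next
      case 2
      moreover have "\<bar>u + w\<bar> < \<bar>int q\<bar>" "u \<ge> 0" "w \<ge> 0"
        using that(1,2) h by (auto simp: P_def)
      ultimately show ?thesis
        using dvd_imp_le_int[of "u + w" "int q"] by fastforce
    qed
  qed
  have "inj_on f P"
    by (intro inj_onI sq_inj) (auto simp: f_def mod_eq_dvd_iff)
  moreover have "inj_on g P"
  proof (rule inj_onI)
    fix u w assume "u \<in> P" "w \<in> P" "g u = g w"
    then have "int q dvd d * (u\<^sup>2 - w\<^sup>2)"
      by (simp add: g_def mod_eq_dvd_iff right_diff_distrib)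
    then have "int q dvd u\<^sup>2 - w\<^sup>2"
      using prime assms(3) prime_dvd_multD by blast
    then show "u = w"
      using sq_inj \<open>u \<in> P\<close> \<open>w \<in> P\<close> by blast
  qed
  ultimately have card: "card (f ` P) = h + 1" "card (g ` P) = h + 1"
    by (simp_all add: card_image P_def)
  have "f ` P \<inter> g ` P \<noteq> {}"
  proof
    assume "f ` P \<inter> g ` P = {}"
    then have "card (f ` P \<union> g ` P) = 2 * h + 2"
      using card by (subst card_Un_disjoint) (auto simp: P_def)
    moreover have "card (f ` P \<union> g ` P) \<le> card {0..<int q}"
      using h by (intro card_mono) (auto simp: f_def g_def)
    ultimately show False
      using h by simp
  qed
  then obtain u b where "f u = g b"
    by blast
  then show ?thesis
    by (auto simp: f_def g_def mod_eq_dvd_iff)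
qed

text \<open>In terms of u = 2(a + b) - 1 the conic is u^2 + 1 = 2(n + 2) b^2, and a \<noteq> 0 says
  that u + 1 \<noteq> 2b. If n + 2 vanishes modulo \<open>q\<close>, a square root of -1 is
  required, which is where \<open>q\<close> = 1 modulo 4 enters.\<close>

lemma lower_bound_parameters:
  assumes "prime q" "odd q" and cond: "\<not> [int n = - 2] (mod int q) \<or> [q = 1] (mod 4)"
  shows "\<exists>a b. \<not> int q dvd a \<and> int q dvd (2 * (a + b) - 1)\<^sup>2 + 1 - 2 * (int n + 2) * b\<^sup>2"
proof -
  obtain h where h: "q = 2 * h + 1"
    using \<open>odd q\<close> oddE by blast
  have "h > 0"
    using h \<open>prime q\<close> prime_gt_1_nat[of q] by simp
  have prime: "prime (int q)"
    using \<open>prime q\<close> by simp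
  have not2: "\<not> int q dvd 2"
    using h \<open>h > 0\<close> zdvd_imp_le[of "int q" 2] by auto
  have suffices: ?thesis
    if ub: "int q dvd u\<^sup>2 + 1 - 2 * (int n + 2) * b\<^sup>2" and ne: "\<not> int q dvd u + 1 - 2 * b" for u b
  proof (intro exI conjI)
    \<comment> \<open>\<open>h + 1\<close> is the inverse of 2, so \<open>a\<close> represents (u + 1) / 2 - b.\<close>
    define a where "a = (int h + 1) * (u + 1) - b"
    have 2: "2 * a = u + 1 - 2 * b + int q * (u + 1)"
      using h by (simp add: a_def algebra_simps)
    show "\<not> int q dvd a"
    proof
      assume "int q dvd a"
      then have "int q dvd u + 1 - 2 * b + int q * (u + 1)"
        unfolding 2[symmetric] by (rule dvd_mult)
      then show False
        using ne by (simp add: dvd_add_left_iff)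
    qed
    have "2 * (a + b) - 1 = u + int q * (u + 1)"
      using 2 by simp
    then have "(2 * (a + b) - 1)\<^sup>2 + 1 - 2 * (int n + 2) * b\<^sup>2 =
        (u\<^sup>2 + 1 - 2 * (int n + 2) * b\<^sup>2) + int q * (2 * u * (u + 1) + int q * (u + 1)\<^sup>2)"
      by (simp only:) (simp add: power2_eq_square algebra_simps)
    then show "int q dvd (2 * (a + b) - 1)\<^sup>2 + 1 - 2 * (int n + 2) * b\<^sup>2"
      using ub by (metis dvd_add dvd_triv_left)
  qed
  show ?thesis
  proof (cases "int q dvd int n + 2")
    case False
    then have "\<not> int q dvd 2 * (int n + 2)"
      using not2 prime prime_dvd_multD by blast
    then obtain u b where ub: "int q dvd u\<^sup>2 + 1 - 2 * (int n + 2) * b\<^sup>2"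
      using conic_solvable assms(1,2) by blast
    \<comment> \<open>If all sign changes of the solution were excluded, then their sum would vanish as well.\<close>
    have "\<not> int q dvd u + 1 - 2 * b \<or> \<not> int q dvd - u + 1 - 2 * (- b)"
    proof (rule ccontr)
      assume "\<not> ?thesis"
      then have "int q dvd (u + 1 - 2 * b) + (- u + 1 - 2 * (- b))"
        using dvd_add by blast
      then show False
        using not2 by simp
    qed
    then show ?thesis
      using suffices[of u b] suffices[of "- u" "- b"] ub by auto
  next
    case True
    then have "[q = 1] (mod 4)"
      using cond by (simp add: cong_iff_dvd_diff)
    have "(q - 1) div 2 = h"
      using h by simp
    moreover have "even h"
      using \<open>[q = 1] (mod 4)\<close> h unfolding cong_def by presburger
    moreover have "[Legendre (- 1) (int q) = (- 1) ^ ((q - 1) div 2)] (mod int q)"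
      using \<open>prime q\<close> h \<open>h > 0\<close> by (intro euler_criterion) auto
    ultimately have leg: "[Legendre (- 1) (int q) = 1] (mod int q)"
      by simp
    \<comment> \<open>These rule out the values -1 and 0 of the Legendre symbol, so -1 is a
      quadratic residue.\<close>
    have "\<not> [- 1 = (1::int)] (mod int q)" "\<not> [0 = (1::int)] (mod int q)"
      using not2 h \<open>h > 0\<close> by (auto simp: cong_iff_dvd_diff)
    then obtain u where "[u\<^sup>2 = - 1] (mod int q)"
      using leg by (auto simp: Legendre_def QuadRes_def split: if_splits)
    then have u: "int q dvd u\<^sup>2 + 1"
      by (simp add: cong_iff_dvd_diff)
    have dvd: "int q dvd u\<^sup>2 + 1 - 2 * (int n + 2) * b\<^sup>2" for b
      using u True by (intro dvd_diff dvd_mult2[OF dvd_mult])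
    \<comment> \<open>\<open>b\<close> is now free. The choices 0 and 1 give values of u + 1 - 2b
      that differ by 2, so at most one of them is excluded.\<close>
    have "\<not> int q dvd u + 1 - 2 * 0 \<or> \<not> int q dvd u + 1 - 2 * 1"
    proof (rule ccontr)
      assume "\<not> ?thesis"
      then have "int q dvd (u + 1 - 2 * 0) - (u + 1 - 2 * 1)"
        using dvd_diff by blast
      then show False
        using not2 by simp
    qed
    then show ?thesis
      using suffices[OF dvd, of 0] suffices[OF dvd, of 1] by blast
  qed
qed

theorem theorem1p6:
  fixes n q :: nat
  assumes "prime q" and "odd q" and "n > 0"
  shows "n choose (q - 1) \<le> S n q
    \<and> int (S n q) \<le> int ((n + q) choose (q - 1)) - int ((n + q - 2) choose (q - 3))
    \<and> (\<not> [int n = - 2] (mod int q) \<or> [q = 1] (mod 4) \<longrightarrow>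
         (n choose (q - 1)) + (n choose (q - 2)) \<le> S n q)"
proof (intro conjI impI)
  show "n choose (q - 1) \<le> S n q"
    using assms by (intro binomial_le_S)
  have "q \<ge> 3"
    using assms(1,2) prime_ge_2_nat[of q] by (cases "q = 2") auto
  obtain A where "admissible n q A" "card A = S n q"
    using S_attained by blast
  then have "S n q \<le> ((n + q - 1) choose (q - 1)) + ((n + q - 2) choose (q - 2))"
    using card_admissible_le assms by metis
  then show "int (S n q) \<le> int ((n + q) choose (q - 1)) - int ((n + q - 2) choose (q - 3))"
    using binomial_identity[OF \<open>q \<ge> 3\<close>, of n] by linarith
  assume "\<not> [int n = - 2] (mod int q) \<or> [q = 1] (mod 4)"
  then show "(n choose (q - 1)) + (n choose (q - 2)) \<le> S n q"
    using lower_bound_parameters[OF assms(1,2)] binomial_sum_le_S[OF assms(1,2)] by blast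
qed

end
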